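(* For every positive integer $t$ there exists an integer $r(t)$ such that every ordered graph $(G,<)$ which does not contain the complete graph $K_t$ as an interval minor has rank at most $r(t)$.
   Context: An ordered graph $(G,<)$ is a finite simple graph $G$ together with a linear order $<$ on $V(G)$. An interval is a set of vertices consecutive in $<$. An ordered graph $(H,<')$ with vertices $u_1<'\dots<'u_h$ is an interval minor of $(G,<)$ if $V(G)$ can be partitioned into nonempty intervals $I_1<\dots<I_h$ (every vertex of $I_i$ precedes every vertex of $I_{i+1}$) such that whenever $u_iu_j\in E(H)$ there is an edge of $G$ with one endpoint in $I_i$ and the other in $I_j$ (equivalently, $(H,<')$ is obtained from $(G,<)$ by deleting edges and iteratively contracting pairs of vertices consecutive in the order). In particular $(G,<)$ contains $K_t$ as an interval minor iff $V(G)$ can be partitioned into $t$ nonempty intervals with an edge between any two of them. Operations on classes of ordered graphs. The substitution of a vertex $v$ of $(G,<)$ by an ordered graph $(H,<')$ replaces $v$ by a copy of $H$, keeps the edges of $H$, joins every neighbour of $v$ to every vertex of the copy, and places the vertices of the copy, ordered by $<'$, at the position of $v$ in $<$. The substitution closure $\overline{\mathcal C}$ of a class $\mathcal C$ is the class of ordered graphs obtained from a member of $\mathcal C$ by iterating any number (possibly zero) of substitutions of vertices by members of $\mathcal C$. The edge union $\mathcal C\oplus\mathcal C'$ is the class of ordered graphs $((V,E\cup E'),<)$ where $((V,E),<)\in\mathcal C$ and $((V,E'),<)\in\mathcal C'$ have the same vertex set and the same order. The independent concatenation $\mathcal C^+$ is the class of ordered graphs obtained from some $(G,<)\in\mathcal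 C$ by adding an independent set $I$ of new vertices either entirely before all vertices of $G$ or entirely after them in the order, with arbitrary edges between $I$ and $V(G)$. Rank: the empty graph has rank $0$. For $r\ge1$, the rank of $(G,<)$ is the smallest integer $r$ such that $(G,<)$ can be built from ordered graphs of rank at most $r-1$ by one of the operations above, i.e. $(G,<)$ lies in $\overline{\mathcal R_{r-1}}$, in $\mathcal R_{r-1}\oplus\mathcal R_{r-1}$, or in $\mathcal R_{r-1}^+$, where $\mathcal R_{r-1}$ is the class of ordered graphs of rank at most $r-1$. *)

theory Defs
  imports Main "HOL-Library.Extended_Nat"
begin

record 'a ograph =
  verts :: "'a set"
  edges :: "'a set set"
  prec :: "('a \<times> 'a) set"

text \<open>The order \<^term>\<open>prec G\<close> is the strict one, and it is confined to the vertex set, so that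
  two ordered graphs on the same vertices with the same order have equal \<^const>\<open>prec\<close> fields.\<close>

definition ordered_graph :: "'a ograph \<Rightarrow> bool" where
  "ordered_graph G \<longleftrightarrow>
     finite (verts G) \<and>
     (\<forall>e\<in>edges G. e \<subseteq> verts G \<and> card e = 2) \<and>
     prec G \<subseteq> verts G \<times> verts G \<and>
     strict_linear_order_on (verts G) (prec G)"

definition rename :: "('a \<Rightarrow> 'b) \<Rightarrow> 'a ograph \<Rightarrow> 'b ograph" where
  "rename f G = \<lparr>verts = f ` verts G, edges = (\<lambda>e. f ` e) ` edges G, prec = map_prod f f ` prec G\<rparr>"

definition induced :: "'a ograph \<Rightarrow> 'a set \<Rightarrow> 'a ograph" where
  "induced G S =
     \<lparr>verts = verts G \<inter> S, edges = {e \<in> edges G. e \<subseteq> S}, prec = prec G \<inter> S \<times> S\<rparr>"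

definition is_interval :: "'a ograph \<Rightarrow> 'a set \<Rightarrow> bool" where
  "is_interval G I \<longleftrightarrow>
     I \<subseteq> verts G \<and>
     (\<forall>u\<in>I. \<forall>w\<in>I. \<forall>v. (u, v) \<in> prec G \<and> (v, w) \<in> prec G \<longrightarrow> v \<in> I)"

text \<open>The parts \<open>I x\<close> are indexed by the vertices \<open>x\<close> of \<open>H\<close> themselves instead of by their ranks
  in the order of \<open>H\<close>. The parts are pairwise disjoint because distinct vertices of \<open>H\<close> are
  comparable and the order of \<open>G\<close> is irreflexive.\<close>

definition interval_minor :: "'b ograph \<Rightarrow> 'a ograph \<Rightarrow> bool" where
  "interval_minor H G \<longleftrightarrow>
     (\<exists>I. (\<forall>x\<in>verts H. I x \<noteq> {} \<and> is_interval G (I x)) \<and>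
          (\<Union>x\<in>verts H. I x) = verts G \<and>
          (\<forall>(x, y)\<in>prec H. \<forall>a\<in>I x. \<forall>b\<in>I y. (a, b) \<in> prec G) \<and>
          (\<forall>x y. {x, y} \<in> edges H \<longrightarrow> (\<exists>a\<in>I x. \<exists>b\<in>I y. {a, b} \<in> edges G)))"

definition complete_ograph :: "nat \<Rightarrow> nat ograph" where
  "complete_ograph t =
     \<lparr>verts = {..<t},
      edges = {{i, j} | i j. i < j \<and> j < t},
      prec = {(i, j). i < j \<and> j < t}\<rparr>"

text \<open>Meaningful when \<open>v\<close> is a vertex of \<open>G\<close> and the vertices of \<open>H\<close> are disjoint from those of
  \<open>G\<close> other than \<open>v\<close>.\<close>

definition substitute :: "'a ograph \<Rightarrow> 'a \<Rightarrow> 'a ograph \<Rightarrow> 'a ograph" where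
  "substitute G v H =
     \<lparr>verts = (verts G - {v}) \<union> verts H,
      edges = {e \<in> edges G. v \<notin> e} \<union> edges H \<union>
              {{u, x} | u x. {u, v} \<in> edges G \<and> x \<in> verts H},
      prec = {(a, b) \<in> prec G. a \<noteq> v \<and> b \<noteq> v} \<union> prec H \<union>
             {(a, x). (a, v) \<in> prec G \<and> x \<in> verts H} \<union>
             {(x, b). x \<in> verts H \<and> (v, b) \<in> prec G}\<rparr>"

inductive_set subst_closure :: "'a ograph set \<Rightarrow> 'a ograph set" for C :: "'a ograph set" where
  base: "G \<in> C \<Longrightarrow> G \<in> subst_closure C"
| step: "\<lbrakk>G \<in> subst_closure C; v \<in> verts G; H \<in> C;
          inj_on f (verts H); f ` verts H \<inter> (verts G - {v}) = {}\<rbrakk>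
         \<Longrightarrow> substitute G v (rename f H) \<in> subst_closure C"

definition edge_union :: "'a ograph set \<Rightarrow> 'a ograph set \<Rightarrow> 'a ograph set" where
  "edge_union C C' =
     {\<lparr>verts = V, edges = E \<union> E', prec = R\<rparr> | V E E' R.
        \<lparr>verts = V, edges = E, prec = R\<rparr> \<in> C \<and> \<lparr>verts = V, edges = E', prec = R\<rparr> \<in> C'}"

definition indep_concat :: "'a ograph set \<Rightarrow> 'a ograph set" where
  "indep_concat C =
     {G. ordered_graph G \<and>
         (\<exists>I \<subseteq> verts G.
            induced G (verts G - I) \<in> C \<and>
            (\<forall>e\<in>edges G. \<not> e \<subseteq> I) \<and>
            (I \<times> (verts G - I) \<subseteq> prec G \<or> (verts G - I) \<times> I \<subseteq> prec G))}"

text \<open>\<open>rank_class r\<close> consists of the ordered graphs of rank at most \<open>r\<close> whose vertices are natural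
  numbers; an infinite vertex type is needed so that fresh vertices are always available in
  iterated substitutions. These classes are increasing, as a class is contained in its
  substitution closure, and closed under isomorphism. The empty graph is the graph without
  vertices.\<close>

fun rank_class :: "nat \<Rightarrow> nat ograph set" where
  "rank_class 0 = {\<lparr>verts = {}, edges = {}, prec = {}\<rparr>}"
| "rank_class (Suc r) =
     subst_closure (rank_class r) \<union>
     edge_union (rank_class r) (rank_class r) \<union>
     indep_concat (rank_class r)"

text \<open>The rank of an ordered graph with arbitrary vertices is that of an isomorphic copy on natural
  numbers. Being an infimum in \<^typ>\<open>enat\<close>, it would be \<open>\<infinity>\<close> for a graph in none of the classes.\<close>

definition rank :: "'a ograph \<Rightarrow> enat" where
  "rank G = (INF r \<in> {r. \<exists>f. inj_on f (verts G) \<and> rename f G \<in> rank_class r}. enat r)"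

end

theory Submission
  imports Defs "HOL-Library.Disjoint_Sets"
begin

text \<open>The bound is proved, by induction on \<open>s\<close>, for the larger class of graphs whose vertices are
  partitioned into independent intervals (blocks) such that contracting the blocks leaves no
  \<open>K\<^sub>s\<close> interval minor. Build a tree of intervals, each a union of blocks: the children of \<open>J\<close> are
  the blocks of \<open>J\<close> with a neighbour outside \<open>J\<close> and the maximal runs of blocks without one (if no
  block has one, cut \<open>J\<close> in two). The edges between distinct children of \<open>J\<close>, taken over all \<open>J\<close> of
  even depth, are nested inside isolated vertices of each other, and likewise for odd depth, so
  two substitution closures and one edge union reduce the problem to a single \<open>J\<close>. There, group
  each run with the block following it. Edges inside the groups, and edges to the final run, are
  bipartite with one side preceding the other. Every other group sees the left or the right
  outside of \<open>J\<close>. Consider the edges whose right endpoint lies in a group seeing the left, say.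
  Those crossing the beginning of the first such group are again bipartite; the remaining ones
  have no \<open>K\<^bsub>s-1\<^esub>\<close> minor with respect to the groups, as every part of such a minor could be made
  to see the left of \<open>J\<close>, which would then serve as the missing vertex of \<open>K\<^sub>s\<close>.\<close>

section \<open>Ordered graphs on natural numbers\<close>

text \<open>Pairs in \<open>E\<close> are meant to have the smaller vertex first. The order depends
  on \<open>V\<close> alone, so edge unions become unions of relations.\<close>

definition nat_ograph :: "nat set \<Rightarrow> (nat \<times> nat) set \<Rightarrow> nat ograph" where
  "nat_ograph V E =
     \<lparr>verts = V, edges = {{x, y} | x y. (x, y) \<in> E}, prec = {(x, y). x \<in> V \<and> y \<in> V \<and> x < y}\<rparr>"

lemma ordered_graph_nat_ograph:
  assumes "finite V" "E \<subseteq> V \<times> V" "\<And>x y. (x, y) \<in> E \<Longrightarrow> x < y"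
  shows "ordered_graph (nat_ograph V E)"
proof -
  have "e \<subseteq> V \<and> card e = 2" if e: "e \<in> {{x, y} | x y. (x, y) \<in> E}" for e
  proof -
    obtain x y where "e = {x, y}" "(x, y) \<in> E" using e by auto
    moreover have "x \<noteq> y" using assms(3)[OF \<open>(x, y) \<in> E\<close>] by simp
    ultimately show ?thesis using assms(2) by auto
  qed
  moreover have "strict_linear_order_on V {(x, y). x \<in> V \<and> y \<in> V \<and> x < y}"
    by (auto simp: strict_linear_order_on_def trans_def irrefl_def total_on_def)
  ultimately show ?thesis
    using assms(1) by (auto simp: ordered_graph_def nat_ograph_def)
qed

lemma rank_class_mono:
  assumes "r \<le> r'"
  shows "rank_class r \<subseteq> rank_class r'"
  using assms by (induction rule: dec_induct) (auto intro: subst_closure.base)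

lemma empty_in_rank_class: "nat_ograph {} {} \<in> rank_class r"
  using rank_class_mono[of 0 r] by (auto simp: nat_ograph_def)

lemma edgeless_in_rank_class:
  assumes "finite V"
  shows "nat_ograph V {} \<in> rank_class (Suc r)"
proof -
  have "induced (nat_ograph V {}) (V - V) \<in> rank_class 0"
    by (auto simp: induced_def nat_ograph_def)
  moreover have "ordered_graph (nat_ograph V {})"
    using assms by (intro ordered_graph_nat_ograph) auto
  ultimately have "nat_ograph V {} \<in> indep_concat (rank_class 0)"
    unfolding indep_concat_def by (auto simp: nat_ograph_def intro!: exI[of _ V])
  then have "nat_ograph V {} \<in> rank_class (Suc 0)" by simp
  then show ?thesis using rank_class_mono[of "Suc 0" "Suc r"] by auto
qed

text \<open>The vertices with key \<open>d\<close> at least \<open>q\<close> follow all others and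
  both sides are independent, so one concatenation onto an edgeless graph suffices.\<close>

lemma bipartite_in_rank_class:
  fixes d :: "nat \<Rightarrow> nat"
  assumes V: "finite V" and E: "E \<subseteq> V \<times> V" and d: "mono_on V d"
    and cut: "\<And>x y. (x, y) \<in> E \<Longrightarrow> d x < q \<and> q \<le> d y"
  shows "nat_ograph V E \<in> rank_class (Suc (Suc r))"
proof -
  have less: "x < y" if "x \<in> V" "y \<in> V" "d x < q" "q \<le> d y" for x y
    using mono_onD[OF d that(2,1)] that by (meson leD le_less_trans less_le_trans not_le)
  let ?G = "nat_ograph V E"
  let ?I = "{y \<in> V. q \<le> d y}"
  have "ordered_graph ?G"
    using V E
  proof (rule ordered_graph_nat_ograph)
    fix x y assume "(x, y) \<in> E"
    then show "x < y" using less[of x y] cut[of x y] E by auto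
  qed
  moreover have "induced ?G (verts ?G - ?I) = nat_ograph (V - ?I) {}"
    using E by (auto simp: induced_def nat_ograph_def dest: cut)
  moreover have "nat_ograph (V - ?I) {} \<in> rank_class (Suc r)"
    using V by (intro edgeless_in_rank_class) auto
  moreover have "\<forall>e\<in>edges ?G. \<not> e \<subseteq> ?I"
    by (auto simp: nat_ograph_def dest: cut)
  moreover have "(verts ?G - ?I) \<times> ?I \<subseteq> prec ?G"
    by (auto simp: nat_ograph_def intro: less)
  moreover have "?I \<subseteq> verts ?G" by (auto simp: nat_ograph_def)
  ultimately have "?G \<in> indep_concat (rank_class (Suc r))"
    unfolding indep_concat_def mem_Collect_eq by (intro conjI exI[of _ ?I] disjI2) (simp_all only:)
  then show ?thesis unfolding rank_class.simps(2)[of "Suc r"] by (rule UnI2)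
qed

lemma union_in_rank_class:
  assumes "nat_ograph V E \<in> rank_class r" "nat_ograph V E' \<in> rank_class r"
  shows "nat_ograph V (E \<union> E') \<in> rank_class (Suc r)"
proof -
  have "nat_ograph V (E \<union> E') = \<lparr>verts = V,
      edges = {{x, y} | x y. (x, y) \<in> E} \<union> {{x, y} | x y. (x, y) \<in> E'},
      prec = {(x, y). x \<in> V \<and> y \<in> V \<and> x < y}\<rparr>"
    by (auto simp: nat_ograph_def)
  then have "nat_ograph V (E \<union> E') \<in> edge_union (rank_class r) (rank_class r)"
    using assms unfolding edge_union_def mem_Collect_eq nat_ograph_def by (intro exI conjI)
  then show ?thesis by simp
qed

section \<open>Substituting isolated vertices\<close>

lemma rename_id: "rename id (nat_ograph V E) = nat_ograph V E"
  by (auto simp: rename_def nat_ograph_def map_prod.id)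

text \<open>Substituting the empty graph for an isolated vertex deletes it and keeps
  \<open>F\<close>.\<close>

lemma delete_isolated:
  assumes "nat_ograph V F \<in> subst_closure C" "nat_ograph {} {} \<in> C" "finite D" "D \<subseteq> V"
    and "F \<subseteq> (V - D) \<times> (V - D)"
  shows "nat_ograph (V - D) F \<in> subst_closure C"
  using assms(3,4,5)
proof (induction D rule: finite_induct)
  case empty
  then show ?case using assms(1) by simp
next
  case (insert v D)
  let ?G = "nat_ograph (V - D) F"
  have "?G \<in> subst_closure C" using insert by auto
  then have "substitute ?G v (rename id (nat_ograph {} {})) \<in> subst_closure C"
    using insert assms(2) by (intro subst_closure.step) (auto simp: nat_ograph_def)
  moreover have "substitute ?G v (rename id (nat_ograph {} {})) = nat_ograph (V - insert v D) F"
    using insert.prems unfolding rename_id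
    by (auto simp: substitute_def nat_ograph_def)
  ultimately show ?case by simp
qed

section \<open>Filling isolated vertex sets\<close>

text \<open>Substitution accepts only members of \<open>C\<close>, not of its closure. Quantifying
  over the surrounding graph \<open>F\<close> lets fillings be performed one after another all the
  same.\<close>

definition insertable :: "nat ograph set \<Rightarrow> nat set \<Rightarrow> nat set \<Rightarrow> (nat \<times> nat) set \<Rightarrow> bool" where
  "insertable C V Z X \<longleftrightarrow> X \<subseteq> Z \<times> Z \<and>
     (\<forall>F. F \<subseteq> (V - Z) \<times> (V - Z) \<longrightarrow> nat_ograph V F \<in> subst_closure C \<longrightarrow>
          nat_ograph V (F \<union> X) \<in> subst_closure C)"

lemma insertable_empty: "insertable C V Z {}"
  by (simp add: insertable_def)

text \<open>Once \<open>G\<close> is placed in \<open>J\<close>, the set \<open>Z\<close> is still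
  isolated and can receive \<open>X\<close>.\<close>

lemma insertable_nested:
  assumes "insertable C V J G" "G \<subseteq> (J - Z) \<times> (J - Z)" "insertable C V Z X" "Z \<subseteq> J" "J \<subseteq> V"
  shows "insertable C V J (G \<union> X)"
  unfolding insertable_def
proof (intro conjI allI impI)
  show "G \<union> X \<subseteq> J \<times> J" using assms by (auto simp: insertable_def)
  fix F assume F: "F \<subseteq> (V - J) \<times> (V - J)" "nat_ograph V F \<in> subst_closure C"
  have "nat_ograph V (F \<union> G) \<in> subst_closure C"
    using assms(1) F unfolding insertable_def by blast
  moreover have "F \<union> G \<subseteq> (V - Z) \<times> (V - Z)" using F(1) assms(2,4,5) by blast
  ultimately have "nat_ograph V (F \<union> G \<union> X) \<in> subst_closure C"
    using assms(3) unfolding insertable_def by blast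
  then show "nat_ograph V (F \<union> (G \<union> X)) \<in> subst_closure C" by (simp add: Un_assoc)
qed

lemma insertable_superset:
  assumes "insertable C V Z X" "Z \<subseteq> J"
  shows "insertable C V J X"
  unfolding insertable_def
proof (intro conjI allI impI)
  show "X \<subseteq> J \<times> J" using assms by (auto simp: insertable_def)
  fix F assume "F \<subseteq> (V - J) \<times> (V - J)" and F: "nat_ograph V F \<in> subst_closure C"
  then have "F \<subseteq> (V - Z) \<times> (V - Z)" using assms(2) by blast
  then show "nat_ograph V (F \<union> X) \<in> subst_closure C"
    using assms(1) F by (simp add: insertable_def)
qed

lemma insertable_UN:
  assumes "finite A" "disjoint_family_on Z A" "\<And>i. i \<in> A \<Longrightarrow> Z i \<subseteq> V"
    and "\<And>i. i \<in> A \<Longrightarrow> insertable C V (Z i) (X i)"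
  shows "insertable C V (\<Union>i\<in>A. Z i) (\<Union>i\<in>A. X i)"
  using assms
proof (induction A rule: finite_induct)
  case empty
  then show ?case by (simp add: insertable_empty)
next
  case (insert i A)
  let ?Z = "\<Union>i\<in>insert i A. Z i"
  have IH: "insertable C V (\<Union>i\<in>A. Z i) (\<Union>i\<in>A. X i)"
    using insert by (auto simp: disjoint_family_on_def)
  have "insertable C V ?Z (X i \<union> (\<Union>i\<in>A. X i))"
  proof (rule insertable_nested[OF _ _ IH])
    show "insertable C V ?Z (X i)"
      using insert.prems(3)[of i] by (auto intro: insertable_superset)
    have "Z i \<inter> (\<Union>i\<in>A. Z i) = {}"
      using insert.prems(1) insert.hyps by (auto simp: disjoint_family_on_def)
    moreover have "X i \<subseteq> Z i \<times> Z i" using insert.prems(3)[of i] by (auto simp: insertable_def)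
    ultimately show "X i \<subseteq> (?Z - (\<Union>i\<in>A. Z i)) \<times> (?Z - (\<Union>i\<in>A. Z i))" by blast
  qed (use insert.prems(2) in auto)
  then show ?case by simp
qed

lemma insertable_convex:
  assumes V: "finite V" and J: "J \<subseteq> V" and X: "X \<subseteq> J \<times> J"
    and convex: "\<And>x y z. x \<in> J \<Longrightarrow> z \<in> J \<Longrightarrow> y \<in> V \<Longrightarrow> x \<le> y \<Longrightarrow> y \<le> z \<Longrightarrow> y \<in> J"
    and C: "nat_ograph {} {} \<in> C" "nat_ograph J X \<in> C"
  shows "insertable C V J X"
  unfolding insertable_def
proof (intro conjI allI impI)
  show "X \<subseteq> J \<times> J" by fact
  fix F assume F: "F \<subseteq> (V - J) \<times> (V - J)" "nat_ograph V F \<in> subst_closure C"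
  show "nat_ograph V (F \<union> X) \<in> subst_closure C"
  proof (cases "J = {}")
    case True
    then show ?thesis using F X by simp
  next
    case False
    then obtain v where v: "v \<in> J" by blast
    \<comment> \<open>\<open>J\<close> is isolated in \<open>F\<close>, so it can be shrunk to
      \<open>v\<close>, which is then replaced by the graph on \<open>J\<close>.\<close>
    let ?U = "V - (J - {v})"
    let ?G = "nat_ograph ?U F"
    have "?G \<in> subst_closure C"
      using F J C V by (intro delete_isolated) (auto intro: finite_subset)
    then have "substitute ?G v (rename id (nat_ograph J X)) \<in> subst_closure C"
      using v J C by (intro subst_closure.step) (auto simp: nat_ograph_def)
    moreover have "substitute ?G v (rename id (nat_ograph J X)) = nat_ograph V (F \<union> X)"
    proof -
      \<comment> \<open>By convexity a vertex outside \<open>J\<close> lies on the same side of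
        \<open>v\<close> as of all of \<open>J\<close>, so the copy takes its right place in the
        order.\<close>
      have sep: "u < v \<longleftrightarrow> u < x" "v < u \<longleftrightarrow> x < u" if "u \<in> V - J" "x \<in> J" for u x
        using convex[of x v u] convex[of v x u] that v by (metis DiffD1 DiffD2 nle_le not_le)+
      have "verts (substitute ?G v (nat_ograph J X)) = V"
        using v J by (auto simp: substitute_def nat_ograph_def)
      moreover have "edges (substitute ?G v (nat_ograph J X)) = edges (nat_ograph V (F \<union> X))"
      proof -
        have "{e \<in> edges ?G. v \<notin> e} = edges ?G" "\<And>u. {u, v} \<notin> edges ?G"
          using F(1) v by (auto simp: nat_ograph_def doubleton_eq_iff)
        then have "edges (substitute ?G v (nat_ograph J X)) = edges ?G \<union> edges (nat_ograph J X)"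
          by (simp add: substitute_def)
        then show ?thesis by (auto simp: nat_ograph_def)
      qed
      moreover have "prec (substitute ?G v (nat_ograph J X)) = prec (nat_ograph V (F \<union> X))"
      proof (rule set_eqI)
        fix p :: "nat \<times> nat"
        obtain a c where p: "p = (a, c)" by fastforce
        show "p \<in> prec (substitute ?G v (nat_ograph J X)) \<longleftrightarrow> p \<in> prec (nat_ograph V (F \<union> X))"
          using J v sep[of a c] sep[of c a] unfolding p
          by (cases "a \<in> J"; cases "c \<in> J") (auto simp: substitute_def nat_ograph_def)
      qed
      ultimately show ?thesis unfolding rename_id
        by (simp add: nat_ograph_def)
    qed
    ultimately show ?thesis by simp
  qed
qed

section \<open>Blocks\<close>

text \<open>The parts of the minor are the fibres of \<open>h \<circ> b\<close> over \<open>{..<s}\<close>; they consist of whole blocks,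
  and what lies beyond the last part is not absorbed into it. For \<open>s \<le> 1\<close> the condition is
  vacuous, even on the empty graph.\<close>

definition has_clique_minor :: "(nat \<times> nat) set \<Rightarrow> (nat \<Rightarrow> nat) \<Rightarrow> nat \<Rightarrow> bool" where
  "has_clique_minor E b s \<longleftrightarrow>
     (\<exists>h. mono h \<and> (\<forall>i j. i < j \<and> j < s \<longrightarrow> (\<exists>(x, y)\<in>E. h (b x) = i \<and> h (b y) = j)))"

text \<open>The blocks are the fibres of \<open>b\<close>; \<open>b_less\<close> makes them
  independent and directs the edges to the right. Merging blocks means composing \<open>b\<close>
  with a monotone map.\<close>

locale block_graph =
  fixes V :: "nat set" and E :: "(nat \<times> nat) set" and b :: "nat \<Rightarrow> nat"
  assumes fin: "finite V" and edges_in: "E \<subseteq> V \<times> V" and mono_b: "mono_on V b"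
    and b_less: "\<And>x y. (x, y) \<in> E \<Longrightarrow> b x < b y"
begin

text \<open>Convexity is in the labels: for \<open>x = z\<close> it says that blocks are contained
  as a whole.\<close>

definition block_interval :: "nat set \<Rightarrow> bool" where
  "block_interval J \<longleftrightarrow> J \<subseteq> V \<and>
     (\<forall>x\<in>J. \<forall>z\<in>J. \<forall>y\<in>V. b x \<le> b y \<and> b y \<le> b z \<longrightarrow> y \<in> J)"

definition confined :: "nat set \<Rightarrow> nat set \<Rightarrow> bool" where
  "confined K J \<longleftrightarrow> (\<forall>(x, y)\<in>E. (x \<in> K \<longrightarrow> y \<in> J) \<and> (y \<in> K \<longrightarrow> x \<in> J))"

text \<open>The fibres are the children of \<open>J\<close> in the tree. A child with edges is split
  again: properness gives termination, confinement isolates it from the edges between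
  \<open>J\<close> and its siblings.\<close>

definition splits :: "nat set \<Rightarrow> (nat \<Rightarrow> nat) \<Rightarrow> bool" where
  "splits J c \<longleftrightarrow> mono c \<and>
     (\<forall>i. E \<inter> {x \<in> J. c (b x) = i} \<times> {x \<in> J. c (b x) = i} = {} \<or>
          {x \<in> J. c (b x) = i} \<subset> J \<and> confined {x \<in> J. c (b x) = i} J)"

lemma block_interval_fibre:
  assumes "block_interval J" "mono c"
  shows "block_interval {x \<in> J. c (b x) = i}"
  unfolding block_interval_def
proof (intro conjI ballI impI)
  show "{x \<in> J. c (b x) = i} \<subseteq> V" using assms(1) by (auto simp: block_interval_def)
  fix x z y assume "x \<in> {x \<in> J. c (b x) = i}" "z \<in> {x \<in> J. c (b x) = i}" "y \<in> V"
    and le: "b x \<le> b y \<and> b y \<le> b z"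
  then have *: "x \<in> J" "z \<in> J" "y \<in> V" "c (b x) = i" "c (b z) = i" by auto
  then have "y \<in> J" using assms(1) le unfolding block_interval_def by blast
  moreover have "c (b x) \<le> c (b y)" "c (b y) \<le> c (b z)" using le monoD[OF assms(2)] by auto
  ultimately show "y \<in> {x \<in> J. c (b x) = i}" using * by simp
qed

lemma finite_block_interval: "block_interval J \<Longrightarrow> finite J"
  unfolding block_interval_def using fin finite_subset by blast

lemma mono_on_block_interval:
  assumes "block_interval J" "mono f"
  shows "mono_on J (\<lambda>x. f (b x))"
proof (rule mono_onI)
  fix x y assume xy: "x \<in> J" "y \<in> J" "x \<le> y"
  have "J \<subseteq> V" using assms(1) by (simp add: block_interval_def)
  then have "b x \<le> b y" using xy mono_onD[OF mono_b, of x y] by blast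
  then show "f (b x) \<le> f (b y)" by (rule monoD[OF assms(2)])
qed

lemma insertable_block_interval:
  assumes J: "block_interval J" and X: "X \<subseteq> J \<times> J" "nat_ograph J X \<in> rank_class r"
  shows "insertable (rank_class r) V J X"
proof (rule insertable_convex[OF fin _ X(1) _ empty_in_rank_class X(2)])
  show "J \<subseteq> V" using J by (simp add: block_interval_def)
  fix x y z assume "x \<in> J" "z \<in> J" "y \<in> V" "x \<le> y" "y \<le> z"
  moreover from this have "b x \<le> b y" "b y \<le> b z"
    using \<open>J \<subseteq> V\<close> mono_onD[OF mono_b, of x y] mono_onD[OF mono_b, of y z] by auto
  ultimately show "y \<in> J" using J unfolding block_interval_def by blast
qed

text \<open>\<open>E0\<close> collects the edges whose least common ancestor in the tree of intervals has even depth
  below \<open>J\<close>, and \<open>E1\<close> the others; \<open>Z\<close> is the union of the children of \<open>J\<close> that contain edges. The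
  conclusion that \<open>Z\<close> is confined to \<open>J\<close> makes \<open>Z\<close> isolated among the edges between \<open>J\<close> and its
  siblings, which is what the induction step for the parent of \<open>J\<close> needs.\<close>

lemma two_level_decomposition:
  assumes split: "\<And>J. block_interval J \<Longrightarrow> E \<inter> J \<times> J \<noteq> {} \<Longrightarrow>
     \<exists>c. splits J c \<and> nat_ograph J {(x, y) \<in> E \<inter> J \<times> J. c (b x) \<noteq> c (b y)} \<in> rank_class r"
    and J: "block_interval J"
  shows "\<exists>E0 E1 Z. E \<inter> J \<times> J = E0 \<union> E1 \<and> insertable (rank_class r) V J E0 \<and>
     Z \<subseteq> J \<and> insertable (rank_class r) V Z E1 \<and> confined Z J"
proof -
  have "finite J" using J by (rule finite_block_interval)
  then show ?thesis using J
  proof (induction J rule: finite_psubset_induct)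
    case (psubset J)
    let ?ins = "insertable (rank_class r) V"
    show ?case
    proof (cases "E \<inter> J \<times> J = {}")
      case True
      then show ?thesis
        by (intro exI[of _ "{}"]) (auto simp: insertable_empty confined_def)
    next
      case False
      then obtain c where c: "splits J c"
        and G: "nat_ograph J {(x, y) \<in> E \<inter> J \<times> J. c (b x) \<noteq> c (b y)} \<in> rank_class r"
        using split[OF psubset.prems] by blast
      define K where "K i = {x \<in> J. c (b x) = i}" for i
      define A where "A = {i \<in> (\<lambda>x. c (b x)) ` J. E \<inter> K i \<times> K i \<noteq> {}}"
      let ?G = "{(x, y) \<in> E \<inter> J \<times> J. c (b x) \<noteq> c (b y)}"
      have JV: "J \<subseteq> V" using psubset.prems by (simp add: block_interval_def)
      have K: "K i \<subset> J \<and> confined (K i) J \<and> block_interval (K i)" if "i \<in> A" for i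
        using c that block_interval_fibre[OF psubset.prems, of c i]
        unfolding A_def K_def splits_def by blast
      have "\<forall>i\<in>A. \<exists>E0 E1 Z. E \<inter> K i \<times> K i = E0 \<union> E1 \<and> ?ins (K i) E0 \<and>
          Z \<subseteq> K i \<and> ?ins Z E1 \<and> confined Z (K i)"
      proof
        fix i assume "i \<in> A"
        then show "\<exists>E0 E1 Z. E \<inter> K i \<times> K i = E0 \<union> E1 \<and> ?ins (K i) E0 \<and>
          Z \<subseteq> K i \<and> ?ins Z E1 \<and> confined Z (K i)"
          using K by (intro psubset.IH) auto
      qed
      then obtain E0 E1 Z where IH: "\<And>i. i \<in> A \<Longrightarrow> E \<inter> K i \<times> K i = E0 i \<union> E1 i \<and>
          ?ins (K i) (E0 i) \<and> Z i \<subseteq> K i \<and> ?ins (Z i) (E1 i) \<and> confined (Z i) (K i)"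
        by metis
      have finA: "finite A" using psubset.hyps by (simp add: A_def)
      have disjK: "disjoint_family_on K A"
        by (auto simp: disjoint_family_on_def K_def)
      have disjZ: "disjoint_family_on Z A"
        using disjK IH unfolding disjoint_family_on_def by blast
      have ZK: "Z i \<subseteq> K i" if "i \<in> A" for i using IH[OF that] by simp
      have KV: "K i \<subseteq> V" for i using JV by (auto simp: K_def)
      have insZ: "?ins (\<Union>i\<in>A. Z i) (\<Union>i\<in>A. E1 i)"
        using IH KV by (intro insertable_UN[OF finA disjZ] order_trans[OF ZK KV]) auto
      have insK: "?ins (\<Union>i\<in>A. K i) (\<Union>i\<in>A. E0 i)"
        using IH KV by (intro insertable_UN[OF finA disjK]) auto
      \<comment> \<open>Neighbours of \<open>Z i\<close> stay in the child \<open>K i\<close>, so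
        edges between different children miss \<open>Z i\<close>.\<close>
      have avoid: "x \<notin> Z i \<and> y \<notin> Z i" if "i \<in> A" "(x, y) \<in> E" "c (b x) \<noteq> c (b y)" for x y i
      proof -
        have "confined (Z i) (K i)" using IH[OF that(1)] by simp
        then have "x \<in> Z i \<Longrightarrow> y \<in> K i" "y \<in> Z i \<Longrightarrow> x \<in> K i"
          using that(2) unfolding confined_def by auto
        then show ?thesis using ZK[OF that(1)] that(3) by (auto simp: K_def)
      qed
      \<comment> \<open>Parities alternate: the edges between children of \<open>J\<close> join the
        \<open>E1\<close> of the children, whose \<open>E0\<close> form the other layer of
        \<open>J\<close>.\<close>
      have "?ins J (?G \<union> (\<Union>i\<in>A. E1 i))"
      proof (rule insertable_nested[OF _ _ insZ _ JV])
        show "?ins J ?G"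
          using G by (intro insertable_block_interval[OF psubset.prems]) auto
        show "?G \<subseteq> (J - (\<Union>i\<in>A. Z i)) \<times> (J - (\<Union>i\<in>A. Z i))"
          using avoid by auto
        show "(\<Union>i\<in>A. Z i) \<subseteq> J" using ZK K by blast
      qed
      moreover have "E \<inter> J \<times> J = (?G \<union> (\<Union>i\<in>A. E1 i)) \<union> (\<Union>i\<in>A. E0 i)"
      proof -
        have "E \<inter> J \<times> J = ?G \<union> (\<Union>i\<in>A. E \<inter> K i \<times> K i)"
          by (auto simp: A_def K_def)
        also have "(\<Union>i\<in>A. E \<inter> K i \<times> K i) = (\<Union>i\<in>A. E0 i \<union> E1 i)"
          using IH by (intro SUP_cong) auto
        finally show ?thesis by blast
      qed
      moreover have "(\<Union>i\<in>A. K i) \<subseteq> J" using K by blast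
      moreover have "confined (\<Union>i\<in>A. K i) J"
        using K unfolding confined_def by blast
      ultimately show ?thesis using insK by (intro exI conjI)
    qed
  qed
qed

section \<open>Enlarging clique minors by the outside of an interval\<close>

text \<open>Everything before \<open>J\<close> becomes a new part 0 and the old parts move up by
  one; \<open>left\<close> supplies the edges from part 0.\<close>

lemma clique_minor_add_left:
  assumes J: "block_interval J" and X: "X \<subseteq> E \<inter> J \<times> J" and h: "mono h" and g: "mono g"
    and minor: "\<And>i j. i < j \<Longrightarrow> j < m \<Longrightarrow> \<exists>(x, y)\<in>X. h (g (b x)) = i \<and> h (g (b y)) = j"
    and left: "\<And>i. i < m \<Longrightarrow> \<exists>(u, w)\<in>E. u \<notin> J \<and> w \<in> J \<and> h (g (b w)) = i"
  shows "has_clique_minor E b (Suc m)"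
proof -
  let ?h = "\<lambda>\<beta>. if \<exists>x\<in>J. b x \<le> \<beta> then Suc (h (g \<beta>)) else 0"
  have "mono ?h"
    using h g by (intro monoI) (auto intro: monoD order_trans)
  moreover have "\<exists>(x, y)\<in>E. ?h (b x) = i \<and> ?h (b y) = j" if ij: "i < j" "j < Suc m" for i j
  proof (cases i)
    case 0
    obtain u w where uw: "(u, w) \<in> E" "u \<notin> J" "w \<in> J" "h (g (b w)) = j - 1"
      using left[of "j - 1"] ij by force
    have "\<not> (\<exists>x\<in>J. b x \<le> b u)"
      using uw J edges_in b_less[OF uw(1)] unfolding block_interval_def
      by (meson SigmaD1 less_imp_le subsetD)
    then have "?h (b u) = i" "?h (b w) = j" using uw 0 ij by auto
    then show ?thesis using uw(1) by blast
  next
    case (Suc i')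
    then obtain x y where xy: "(x, y) \<in> X" "h (g (b x)) = i'" "h (g (b y)) = j - 1"
      using minor[of i' "j - 1"] ij by force
    then have "x \<in> J" "y \<in> J" "(x, y) \<in> E" using X by auto
    then have "?h (b x) = i" "?h (b y) = j" using xy Suc ij by auto
    then show ?thesis using \<open>(x, y) \<in> E\<close> by blast
  qed
  ultimately show ?thesis unfolding has_clique_minor_def by blast
qed

lemma clique_minor_add_right:
  assumes J: "block_interval J" and X: "X \<subseteq> E \<inter> J \<times> J" and h: "mono h" and g: "mono g"
    and minor: "\<And>i j. i < j \<Longrightarrow> j < m \<Longrightarrow> \<exists>(x, y)\<in>X. h (g (b x)) = i \<and> h (g (b y)) = j"
    and right: "\<And>i. i < m \<Longrightarrow> \<exists>(w, u)\<in>E. u \<notin> J \<and> w \<in> J \<and> h (g (b w)) = i"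
  shows "has_clique_minor E b (Suc m)"
proof -
  \<comment> \<open>\<open>h\<close> may exceed \<open>m\<close> on \<open>J\<close>; capping moves
    such labels into the new part \<open>m\<close>, formed by what follows \<open>J\<close>.\<close>
  let ?h = "\<lambda>\<beta>. if \<exists>x\<in>J. \<beta> \<le> b x then min (h (g \<beta>)) m else m"
  have "mono ?h"
    using h g by (intro monoI) (auto intro: monoD order_trans simp: min_le_iff_disj)
  moreover have "\<exists>(x, y)\<in>E. ?h (b x) = i \<and> ?h (b y) = j" if ij: "i < j" "j < Suc m" for i j
  proof (cases "j = m")
    case True
    obtain u w where uw: "(w, u) \<in> E" "u \<notin> J" "w \<in> J" "h (g (b w)) = i"
      using right[of i] ij by force
    have "\<not> (\<exists>x\<in>J. b u \<le> b x)"
      using uw J edges_in b_less[OF uw(1)] unfolding block_interval_def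
      by (meson SigmaD2 less_imp_le subsetD)
    then have "?h (b u) = j" "?h (b w) = i" using uw True ij by auto
    then show ?thesis using uw(1) by blast
  next
    case False
    then obtain x y where xy: "(x, y) \<in> X" "h (g (b x)) = i" "h (g (b y)) = j"
      using minor[of i j] ij by force
    then have "x \<in> J" "y \<in> J" "(x, y) \<in> E" using X by auto
    then have "?h (b x) = i" "?h (b y) = j" using xy ij by auto
    then show ?thesis using \<open>(x, y) \<in> E\<close> by blast
  qed
  ultimately show ?thesis unfolding has_clique_minor_def by blast
qed


text \<open>Cutting at the least element \<open>q\<close> of \<open>P\<close> ensures that also the first part of a minor, which
  need not contain a right endpoint of an edge, meets \<open>P\<close>.\<close>

lemma edges_into_rank_class:
  fixes g :: "nat \<Rightarrow> nat"
  assumes J: "block_interval J" and g: "mono g" and m: "m \<ge> 2"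
    and IH: "\<And>V' E' b'. block_graph V' E' b' \<Longrightarrow> \<not> has_clique_minor E' b' m \<Longrightarrow>
      nat_ograph V' E' \<in> rank_class (Suc (Suc r))"
    and extend: "\<And>X h. X \<subseteq> E \<inter> J \<times> J \<Longrightarrow> mono h \<Longrightarrow>
      (\<And>i j. i < j \<Longrightarrow> j < m \<Longrightarrow> \<exists>(x, y)\<in>X. h (g (b x)) = i \<and> h (g (b y)) = j) \<Longrightarrow>
      (\<And>i. i < m \<Longrightarrow> \<exists>p\<in>P. h p = i) \<Longrightarrow> False"
  shows "nat_ograph J {(x, y) \<in> E \<inter> J \<times> J. g (b x) < g (b y) \<and> g (b y) \<in> P}
    \<in> rank_class (Suc (Suc (Suc r)))" (is "nat_ograph J ?Y \<in> _")
proof -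
  define q where "q = (LEAST p. p \<in> P)"
  let ?B = "{(x, y) \<in> ?Y. g (b x) < q}" and ?X = "{(x, y) \<in> ?Y. q \<le> g (b x)}"
  have finJ: "finite J" using J(1) by (rule finite_block_interval)
  have mono_d: "mono_on J (\<lambda>x. g (b x))"
    using J g by (rule mono_on_block_interval)
  have "nat_ograph J ?B \<in> rank_class (Suc (Suc r))"
    by (rule bipartite_in_rank_class[OF finJ _ mono_d, of _ q]) (auto simp: q_def intro: Least_le)
  moreover have "nat_ograph J ?X \<in> rank_class (Suc (Suc r))"
  proof (rule IH)
    \<comment> \<open>The groups, each merged into one block, are independent in
      \<open>?X\<close>.\<close>
    show "block_graph J ?X (\<lambda>x. g (b x))"
      using finJ mono_d by unfold_locales auto
    show "\<not> has_clique_minor ?X (\<lambda>x. g (b x)) m"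
    proof
      assume "has_clique_minor ?X (\<lambda>x. g (b x)) m"
      then obtain h where h: "mono h" and
        minor: "\<And>i j. i < j \<Longrightarrow> j < m \<Longrightarrow> \<exists>(x, y)\<in>?X. h (g (b x)) = i \<and> h (g (b y)) = j"
        unfolding has_clique_minor_def by blast
      have "\<exists>p\<in>P. h p = i" if i: "i < m" for i
      proof (cases "i = 0")
        case True
        \<comment> \<open>Only a left endpoint is known to lie in part 0; \<open>q\<close> is at
          most its group, so monotonicity gives \<open>h q = 0\<close>.\<close>
        obtain x y where xy: "(x, y) \<in> ?X" "h (g (b x)) = 0" using minor[of 0 1] m by force
        then have "q \<in> P" unfolding q_def by (auto intro: LeastI)
        moreover have "h q \<le> h (g (b x))" using xy(1) h by (auto intro: monoD)
        ultimately show ?thesis using xy(2) True by auto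
      next
        case False
        then show ?thesis using minor[of 0 i] i by force
      qed
      then show False using extend[of ?X h, OF _ h minor] by blast
    qed
  qed
  ultimately have "nat_ograph J (?B \<union> ?X) \<in> rank_class (Suc (Suc (Suc r)))"
    by (rule union_in_rank_class)
  moreover have "?B \<union> ?X = ?Y" by auto
  ultimately show ?thesis by simp
qed

section \<open>Splitting one interval\<close>

text \<open>Subsets of \<open>J\<close> are confined to \<open>J\<close> too, so any cut into proper
  parts works, and the crossing edges are bipartite. Cutting just before the block of a right
  endpoint is proper.\<close>

lemma split_confined:
  assumes J: "block_interval J" "E \<inter> J \<times> J \<noteq> {}" "confined J J"
  shows "\<exists>c. splits J c \<and>
    nat_ograph J {(x, y) \<in> E \<inter> J \<times> J. c (b x) \<noteq> c (b y)} \<in> rank_class (Suc (Suc r))"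
proof -
  obtain x0 y0 where xy: "(x0, y0) \<in> E" "x0 \<in> J" "y0 \<in> J" using J(2) by auto
  define c :: "nat \<Rightarrow> nat" where "c \<beta> = (if b y0 \<le> \<beta> then 1 else 0)" for \<beta>
  have c: "mono c" by (auto simp: mono_def c_def)
  have finJ: "finite J" using J(1) by (rule finite_block_interval)
  have mono_c: "mono_on J (\<lambda>x. c (b x))"
    using J(1) c by (rule mono_on_block_interval)
  have "c (b x0) = 0" "c (b y0) = 1" using b_less[OF xy(1)] by (auto simp: c_def)
  then have "{x \<in> J. c (b x) = i} \<subset> J" for i
    using xy(2,3) by (metis (mono_tags, lifting) mem_Collect_eq psubsetI subsetI zero_neq_one)
  moreover have "confined {x \<in> J. c (b x) = i} J" for i
    using J(3) by (auto simp: confined_def)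
  moreover have "nat_ograph J {(x, y) \<in> E \<inter> J \<times> J. c (b x) \<noteq> c (b y)} \<in> rank_class (Suc (Suc r))"
    using b_less
    by (intro bipartite_in_rank_class[OF finJ _ mono_c, of _ 1])
       (auto simp: c_def split: if_splits dest: less_imp_le order_trans)
  ultimately show ?thesis using c unfolding splits_def by blast
qed

text \<open>Four classes, each in \<open>rank_class (r + 3)\<close>, cover the edges between
  children: the group of the right endpoint sees the left, sees the right, or is the final run, or
  both endpoints share a group. Two rounds of edge union give \<open>r + 5\<close>.\<close>

lemma split_interval:
  assumes noK: "\<not> has_clique_minor E b (Suc m)" and m: "m \<ge> 2"
    and IH: "\<And>V' E' b'. block_graph V' E' b' \<Longrightarrow> \<not> has_clique_minor E' b' m \<Longrightarrow>
      nat_ograph V' E' \<in> rank_class (Suc (Suc r))"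
    and J: "block_interval J" "E \<inter> J \<times> J \<noteq> {}"
  shows "\<exists>c. splits J c \<and>
    nat_ograph J {(x, y) \<in> E \<inter> J \<times> J. c (b x) \<noteq> c (b y)} \<in> rank_class (r + 5)"
proof (cases "confined J J")
  case True
  then show ?thesis using split_confined[OF J, of "r + 3"] by (simp add: eval_nat_numeral)
next
  case False
  \<comment> \<open>\<open>\<sigma>\<close> holds the labels of the blocks with a neighbour outside
    \<open>J\<close>. \<open>g\<close> counts those strictly below, so such a block shares its
    number with the run before it; \<open>c\<close> tells the two apart by parity.\<close>
  define \<sigma> where "\<sigma> = b ` {w \<in> J. \<exists>u. u \<notin> J \<and> ((u, w) \<in> E \<or> (w, u) \<in> E)}"
  define g where "g \<beta> = card {\<beta>' \<in> \<sigma>. \<beta>' < \<beta>}" for \<beta>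
  define c where "c \<beta> = 2 * g \<beta> + (if \<beta> \<in> \<sigma> then 1 else 0)" for \<beta>
  have finJ: "finite J" using J(1) by (rule finite_block_interval)
  have fin\<sigma>: "finite \<sigma>" using finJ by (simp add: \<sigma>_def)
  have g: "mono g" unfolding g_def using fin\<sigma> by (intro monoI card_mono) auto
  have g_less: "g \<beta> < g \<beta>'" if "\<beta> \<in> \<sigma>" "\<beta> < \<beta>'" for \<beta> \<beta>'
    unfolding g_def using fin\<sigma> that by (intro psubset_card_mono) auto
  have c: "mono c"
  proof (rule monoI)
    fix \<beta> \<beta>' :: nat assume "\<beta> \<le> \<beta>'"
    then consider "\<beta> = \<beta>'" | "\<beta> < \<beta>'" by linarith
    then show "c \<beta> \<le> c \<beta>'"
      using monoD[OF g \<open>\<beta> \<le> \<beta>'\<close>] g_less[of \<beta> \<beta>'] by cases (auto simp: c_def)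
  qed
  have c_eq: "g \<beta> = g \<beta>' \<and> (\<beta> \<in> \<sigma> \<longleftrightarrow> \<beta>' \<in> \<sigma>)" if "c \<beta> = c \<beta>'" for \<beta> \<beta>'
    using that unfolding c_def by (auto split: if_splits) presburger+
  have mono_d: "mono_on J (\<lambda>x. f (b x))" if "mono f" for f :: "nat \<Rightarrow> nat"
    using J(1) that by (rule mono_on_block_interval)
  have parts: "E \<inter> {x \<in> J. c (b x) = i} \<times> {x \<in> J. c (b x) = i} = {} \<or>
            {x \<in> J. c (b x) = i} \<subset> J \<and> confined {x \<in> J. c (b x) = i} J" for i
  proof (cases "\<exists>x\<in>J. c (b x) = i \<and> b x \<in> \<sigma>")
    case True
    \<comment> \<open>\<open>g\<close> grows right after each label in \<open>\<sigma>\<close>, so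
      this part is a single block and has no edges inside.\<close>
    then have *: "b x \<in> \<sigma>" if "x \<in> J" "c (b x) = i" for x using c_eq that by metis
    have "b x = b y" if "x \<in> J" "c (b x) = i" "y \<in> J" "c (b y) = i" for x y
    proof -
      have "g (b x) = g (b y)" using c_eq that by metis
      then show ?thesis using g_less[of "b x" "b y"] g_less[of "b y" "b x"] *[OF that(1,2)]
          *[OF that(3,4)] by (metis less_irrefl linorder_neqE_nat)
    qed
    then have "(x, y) \<notin> E" if "x \<in> J" "c (b x) = i" "y \<in> J" "c (b y) = i" for x y
      using that b_less[of x y] by force
    then show ?thesis by blast
  next
    case no: False
    then have "confined {x \<in> J. c (b x) = i} J"
      unfolding confined_def \<sigma>_def by blast
    \<comment> \<open>As \<open>J\<close> is not confined, some block has its label in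
      \<open>\<sigma>\<close>; the part misses it and is proper.\<close>
    moreover obtain w where "w \<in> J" "b w \<in> \<sigma>"
      using False unfolding confined_def \<sigma>_def by blast
    ultimately show ?thesis using no by blast
  qed
  let ?E = "E \<inter> J \<times> J"
  \<comment> \<open>The groups seeing the left, and below the right, of \<open>J\<close>; the
    direction of the edge tells the side.\<close>
  define L where "L = {g (b w) | u w. (u, w) \<in> E \<and> u \<notin> J \<and> w \<in> J}"
  define R where "R = {g (b w) | u w. (w, u) \<in> E \<and> u \<notin> J \<and> w \<in> J}"
  have cover: "g \<beta> \<in> L \<union> R" if "g \<beta> < card \<sigma>" for \<beta>
  proof -
    have "\<exists>\<beta>'\<in>\<sigma>. \<beta> \<le> \<beta>'"
    proof (rule ccontr)
      assume "\<not> ?thesis"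
      then have "{\<beta>' \<in> \<sigma>. \<beta>' < \<beta>} = \<sigma>" by auto
      then show False using that by (simp add: g_def)
    qed
    then have ex: "\<exists>\<beta>'. \<beta>' \<in> \<sigma> \<and> \<beta> \<le> \<beta>'" by blast
    \<comment> \<open>The label of the block closing the group of \<open>\<beta>\<close>. Only the
      final run, numbered \<open>card \<sigma>\<close>, lacks one.\<close>
    define \<gamma> where "\<gamma> = (LEAST \<beta>'. \<beta>' \<in> \<sigma> \<and> \<beta> \<le> \<beta>')"
    have \<gamma>: "\<gamma> \<in> \<sigma>" "\<beta> \<le> \<gamma>" using LeastI_ex[OF ex] by (auto simp: \<gamma>_def)
    have "{\<beta>' \<in> \<sigma>. \<beta>' < \<gamma>} = {\<beta>' \<in> \<sigma>. \<beta>' < \<beta>}"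
      using \<gamma>(2) not_less_Least[of _ "\<lambda>\<beta>'. \<beta>' \<in> \<sigma> \<and> \<beta> \<le> \<beta>'"] unfolding \<gamma>_def
      by (auto simp: not_le[symmetric])
    then have "g \<gamma> = g \<beta>" by (simp add: g_def)
    then show ?thesis using \<gamma>(1) unfolding \<sigma>_def L_def R_def by (auto; metis)
  qed
  have g_le: "g \<beta> \<le> card \<sigma>" for \<beta>
    unfolding g_def using fin\<sigma> by (intro card_mono) auto
  have into_L: "nat_ograph J {(x, y) \<in> ?E. g (b x) < g (b y) \<and> g (b y) \<in> L}
      \<in> rank_class (Suc (Suc (Suc r)))"
  proof (rule edges_into_rank_class[OF J(1) g m IH])
    fix X h assume "X \<subseteq> ?E" "mono h"
      "\<And>i j. i < j \<Longrightarrow> j < m \<Longrightarrow> \<exists>(x, y)\<in>X. h (g (b x)) = i \<and> h (g (b y)) = j"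
      "\<And>i. i < m \<Longrightarrow> \<exists>p\<in>L. h p = i"
    then have "has_clique_minor E b (Suc m)"
      by (intro clique_minor_add_left[OF J(1) _ _ g, of X h]) (auto simp: L_def, blast)
    then show False using noK by simp
  qed
  have into_R: "nat_ograph J {(x, y) \<in> ?E. g (b x) < g (b y) \<and> g (b y) \<in> R}
      \<in> rank_class (Suc (Suc (Suc r)))"
  proof (rule edges_into_rank_class[OF J(1) g m IH])
    fix X h assume "X \<subseteq> ?E" "mono h"
      "\<And>i j. i < j \<Longrightarrow> j < m \<Longrightarrow> \<exists>(x, y)\<in>X. h (g (b x)) = i \<and> h (g (b y)) = j"
      "\<And>i. i < m \<Longrightarrow> \<exists>p\<in>R. h p = i"
    then have "has_clique_minor E b (Suc m)"
      by (intro clique_minor_add_right[OF J(1) _ _ g, of X h]) (auto simp: R_def, blast)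
    then show False using noK by simp
  qed
  have last_run: "nat_ograph J {(x, y) \<in> ?E. g (b x) < g (b y) \<and> g (b y) = card \<sigma>}
      \<in> rank_class (Suc (Suc (Suc r)))"
    by (rule bipartite_in_rank_class[OF finJ _ mono_d[OF g], of _ "card \<sigma>"]) auto
  let ?S = "{(x, y) \<in> ?E. g (b x) = g (b y) \<and> c (b x) \<noteq> c (b y)}"
  have same_group: "nat_ograph J ?S \<in> rank_class (Suc (Suc (Suc r)))"
  proof -
    \<comment> \<open>With \<open>J\<close> as the whole vertex set, the groups are disjoint
      intervals to be filled in an edgeless graph.\<close>
    interpret inner: block_graph J ?E b
      using finJ b_less mono_d[of id] by unfold_locales (auto simp: mono_def)
    let ?K = "\<lambda>i. {x \<in> J. g (b x) = i}"
    let ?T = "\<lambda>i. {(x, y) \<in> ?E. g (b x) = i \<and> g (b y) = i \<and> c (b x) \<noteq> c (b y)}"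
    have "insertable (rank_class (Suc (Suc r))) J (?K i) (?T i)" for i
    proof (rule inner.insertable_block_interval)
      show "inner.block_interval (?K i)"
        using g by (intro inner.block_interval_fibre) (auto simp: inner.block_interval_def)
      \<comment> \<open>Edges within group \<open>i\<close> lead from its run, of value
        \<open>2 * i\<close>, to its closing block, of value \<open>2 * i + 1\<close>.\<close>
      show "nat_ograph (?K i) (?T i) \<in> rank_class (Suc (Suc r))"
      proof (rule bipartite_in_rank_class[of _ _ "\<lambda>x. c (b x)" "2 * i + 1"])
        show "mono_on (?K i) (\<lambda>x. c (b x))"
          using mono_d[OF c] by (auto simp: monotone_on_def)
        fix x y assume "(x, y) \<in> ?T i"
        moreover from this have "c (b x) \<le> c (b y)" using b_less c by (auto intro: monoD less_imp_le)
        ultimately show "c (b x) < 2 * i + 1 \<and> 2 * i + 1 \<le> c (b y)"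
          by (auto simp: c_def split: if_splits)
      qed (use finJ in auto)
    qed auto
    then have "insertable (rank_class (Suc (Suc r))) J
        (\<Union>i\<in>{..card \<sigma>}. ?K i) (\<Union>i\<in>{..card \<sigma>}. ?T i)"
      by (intro insertable_UN) (auto simp: disjoint_family_on_def)
    moreover have "(\<Union>i\<in>{..card \<sigma>}. ?T i) = ?S" using g_le by auto
    moreover have "nat_ograph J {} \<in> subst_closure (rank_class (Suc (Suc r)))"
      using finJ by (intro subst_closure.base edgeless_in_rank_class)
    ultimately have "nat_ograph J ({} \<union> ?S) \<in> subst_closure (rank_class (Suc (Suc r)))"
      unfolding insertable_def by (metis (no_types, lifting) empty_subsetI)
    then show ?thesis by simp
  qed
  have "nat_ograph J (({(x, y) \<in> ?E. g (b x) < g (b y) \<and> g (b y) \<in> L} \<union>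
       {(x, y) \<in> ?E. g (b x) < g (b y) \<and> g (b y) \<in> R}) \<union>
      ({(x, y) \<in> ?E. g (b x) < g (b y) \<and> g (b y) = card \<sigma>} \<union> ?S))
      \<in> rank_class (Suc (Suc (Suc (Suc (Suc r)))))"
    by (intro union_in_rank_class into_L into_R last_run same_group)
  moreover have "{(x, y) \<in> ?E. c (b x) \<noteq> c (b y)} =
      ({(x, y) \<in> ?E. g (b x) < g (b y) \<and> g (b y) \<in> L} \<union>
       {(x, y) \<in> ?E. g (b x) < g (b y) \<and> g (b y) \<in> R}) \<union>
      ({(x, y) \<in> ?E. g (b x) < g (b y) \<and> g (b y) = card \<sigma>} \<union> ?S)" (is "?l = ?r")
  proof
    have "g (b x) \<le> g (b y)" if "(x, y) \<in> E" for x y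
      using monoD[OF g] b_less[OF that] by simp
    moreover have "g (b y) \<in> L \<or> g (b y) \<in> R \<or> g (b y) = card \<sigma>" for y
      using cover[of "b y"] g_le[of "b y"] by (auto simp: le_less)
    ultimately show "?l \<subseteq> ?r" by (auto simp: le_less)
    have "c (b x) \<noteq> c (b y)" if "g (b x) < g (b y)" for x y
      using that c_eq[of "b x" "b y"] by auto
    then show "?r \<subseteq> ?l" by auto
  qed
  ultimately have "nat_ograph J {(x, y) \<in> ?E. c (b x) \<noteq> c (b y)} \<in> rank_class (r + 5)"
    by (simp add: eval_nat_numeral del: rank_class.simps)
  then show ?thesis using c parts unfolding splits_def by blast
qed

end

section \<open>Induction on the excluded clique\<close>

text \<open>Each step costs 5: splitting leads from \<open>5 * m + 2\<close> to
  \<open>5 * m + 5\<close>, then substitution closure and edge union add one each.\<close>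

theorem block_graph_rank_bounded:
  "block_graph V E b \<Longrightarrow> \<not> has_clique_minor E b (m + 2) \<Longrightarrow> nat_ograph V E \<in> rank_class (5 * m + 2)"
proof (induction m arbitrary: V E b)
  case 0
  interpret block_graph V E b by fact
  have "E = {}"
  proof (rule ccontr)
    assume "E \<noteq> {}"
    then obtain x y where xy: "(x, y) \<in> E" by auto
    \<comment> \<open>A single edge is already a \<open>K_2\<close> minor: cut before the block of
      its right endpoint.\<close>
    let ?h = "\<lambda>\<beta>. if b y \<le> \<beta> then 1 else 0 :: nat"
    have "mono ?h" by (auto simp: mono_def)
    moreover have "\<exists>(x, y)\<in>E. ?h (b x) = i \<and> ?h (b y) = j" if "i < j \<and> j < 0 + 2" for i j
      using that xy b_less[OF xy] by (intro bexI[of _ "(x, y)"]) auto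
    ultimately have "has_clique_minor E b (0 + 2)" unfolding has_clique_minor_def by blast
    then show False using 0 by simp
  qed
  then show ?case using edgeless_in_rank_class[OF fin, of 1] by (simp add: eval_nat_numeral del: rank_class.simps)
next
  case (Suc m)
  interpret block_graph V E b by fact
  let ?r = "5 * m + 5"
  have "\<exists>E0 E1 Z. E \<inter> V \<times> V = E0 \<union> E1 \<and> insertable (rank_class ?r) V V E0 \<and>
     Z \<subseteq> V \<and> insertable (rank_class ?r) V Z E1 \<and> confined Z V"
  proof (rule two_level_decomposition)
    fix J assume J: "block_interval J" "E \<inter> J \<times> J \<noteq> {}"
    show "\<exists>c. splits J c \<and> nat_ograph J {(x, y) \<in> E \<inter> J \<times> J. c (b x) \<noteq> c (b y)} \<in> rank_class ?r"
      using Suc.prems Suc.IH by (intro split_interval[OF _ _ _ J, of "m + 2"]) auto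
  qed (auto simp: block_interval_def)
  then obtain E0 E1 Z where E: "E \<inter> V \<times> V = E0 \<union> E1"
    and ins: "insertable (rank_class ?r) V V E0" "insertable (rank_class ?r) V Z E1" by blast
  have "nat_ograph V {} \<in> subst_closure (rank_class ?r)"
    using edgeless_in_rank_class[OF fin, of "5 * m + 4"]
    by (intro subst_closure.base) (simp add: eval_nat_numeral del: rank_class.simps)
  then have "nat_ograph V ({} \<union> E0) \<in> subst_closure (rank_class ?r)"
    "nat_ograph V ({} \<union> E1) \<in> subst_closure (rank_class ?r)"
    using ins unfolding insertable_def by blast+
  then have "nat_ograph V E0 \<in> rank_class (Suc ?r)" "nat_ograph V E1 \<in> rank_class (Suc ?r)"
    by (simp_all only: Un_empty_left rank_class.simps Un_iff simp_thms)
  then have "nat_ograph V (E0 \<union> E1) \<in> rank_class (Suc (Suc ?r))"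
    by (rule union_in_rank_class)
  moreover have "E0 \<union> E1 = E" using E edges_in by blast
  ultimately show ?case by (simp add: eval_nat_numeral del: rank_class.simps)
qed

section \<open>Transfer to arbitrary ordered graphs\<close>

lemma rename_to_nat_ograph:
  assumes G: "ordered_graph G" and f: "\<And>u v. (u, v) \<in> prec G \<Longrightarrow> f u < f v"
  shows "rename f G = nat_ograph (f ` verts G) {(f u, f v) | u v. (u, v) \<in> prec G \<and> {u, v} \<in> edges G}"
proof -
  have tot: "(u, v) \<in> prec G \<or> (v, u) \<in> prec G" if "u \<in> verts G" "v \<in> verts G" "u \<noteq> v" for u v
    using G that by (auto simp: ordered_graph_def strict_linear_order_on_def total_on_def)
  have "(\<lambda>e. f ` e) ` edges G =
      {{x, y} | x y. (x, y) \<in> {(f u, f v) | u v. (u, v) \<in> prec G \<and> {u, v} \<in> edges G}}" (is "?l = ?r")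
  proof
    show "?l \<subseteq> ?r"
    proof
      fix e' assume "e' \<in> ?l"
      then obtain e where e: "e \<in> edges G" "e' = f ` e" by blast
      then obtain u v where uv: "e = {u, v}" "u \<noteq> v"
        using G by (auto simp: ordered_graph_def card_2_iff)
      then have "u \<in> verts G" "v \<in> verts G" using e G by (auto simp: ordered_graph_def)
      then consider "(u, v) \<in> prec G" | "(v, u) \<in> prec G" using tot uv by blast
      then obtain u' v' where "(u', v') \<in> prec G" "e = {u', v'}"
        using uv(1) by cases (auto simp: insert_commute)
      then have "(u', v') \<in> prec G \<and> {u', v'} \<in> edges G" "e' = {f u', f v'}" using e by auto
      then show "e' \<in> ?r" by blast
    qed
    show "?r \<subseteq> ?l"
    proof
      fix e' assume "e' \<in> ?r"
      then obtain u v where "e' = f ` {u, v}" "{u, v} \<in> edges G" by auto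
      then show "e' \<in> ?l" by blast
    qed
  qed
  moreover have "map_prod f f ` prec G = {(x, y). x \<in> f ` verts G \<and> y \<in> f ` verts G \<and> x < y}"
  proof -
    have "prec G \<subseteq> verts G \<times> verts G" using G by (simp add: ordered_graph_def)
    moreover have "(f u, f v) \<in> map_prod f f ` prec G"
      if "u \<in> verts G" "v \<in> verts G" "f u < f v" for u v
    proof -
      have "(u, v) \<in> prec G" using tot[of u v] f[of v u] that by force
      then show ?thesis by force
    qed
    ultimately show ?thesis using f by fastforce
  qed
  ultimately show ?thesis unfolding rename_def nat_ograph_def by simp
qed

lemma interval_minor_of_clique_minor:
  assumes G: "ordered_graph G" and f: "\<And>u v. (u, v) \<in> prec G \<Longrightarrow> f u < f v"
    and t: "t \<ge> 1" and ne: "verts G \<noteq> {}"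
    and minor: "has_clique_minor {(f u, f v) | u v. (u, v) \<in> prec G \<and> {u, v} \<in> edges G} id t"
  shows "interval_minor (complete_ograph t) G"
proof -
  obtain h :: "nat \<Rightarrow> nat" where h: "mono h" and hij: "\<And>i j. i < j \<Longrightarrow> j < t \<Longrightarrow>
      \<exists>u v. (u, v) \<in> prec G \<and> {u, v} \<in> edges G \<and> h (f u) = i \<and> h (f v) = j"
    using minor unfolding has_clique_minor_def by fastforce
  have sub: "prec G \<subseteq> verts G \<times> verts G"
    and tot: "\<And>u v. u \<in> verts G \<Longrightarrow> v \<in> verts G \<Longrightarrow> u \<noteq> v \<Longrightarrow> (u, v) \<in> prec G \<or> (v, u) \<in> prec G"
    using G by (auto simp: ordered_graph_def strict_linear_order_on_def total_on_def)
  \<comment> \<open>An interval minor must cover \<open>G\<close>: capping merges what lies beyond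
    the last part into it.\<close>
  define k where "k v = min (h (f v)) (t - 1)" for v
  have k: "k u \<le> k v" if "(u, v) \<in> prec G" for u v
    using monoD[OF h, of "f u" "f v"] f[OF that] by (auto simp: k_def)
  define I where "I i = {v \<in> verts G. k v = i}" for i
  have kij: "\<exists>u v. (u, v) \<in> prec G \<and> {u, v} \<in> edges G \<and> u \<in> I i \<and> v \<in> I j" if "i < j" "j < t" for i j
    using hij[OF that] that sub by (fastforce simp: I_def k_def)
  have "I i \<noteq> {}" if i: "i < t" for i
  \<comment> \<open>For \<open>t = 1\<close> there is no edge to provide a vertex, and
    \<open>ne\<close> is needed instead.\<close>
  proof (cases "t = 1")
    case True
    then show ?thesis using i ne by (auto simp: I_def k_def)
  next
    case False
    then show ?thesis using kij[of 0 i] kij[of 0 1] i t by (cases "i = 0") auto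
  qed
  moreover have "is_interval G (I i)" for i
    unfolding is_interval_def
  proof (intro conjI ballI allI impI)
    fix u w v assume "u \<in> I i" "w \<in> I i" "(u, v) \<in> prec G \<and> (v, w) \<in> prec G"
    then show "v \<in> I i" using k[of u v] k[of v w] sub by (auto simp: I_def)
  qed (auto simp: I_def)
  moreover have "(\<Union>i\<in>{..<t}. I i) = verts G"
    using t by (auto simp: I_def k_def)
  moreover have "(u, v) \<in> prec G" if "i < j" "u \<in> I i" "v \<in> I j" for i j u v
    using tot[of u v] k[of v u] that by (auto simp: I_def)
  moreover have "\<exists>u\<in>I i. \<exists>v\<in>I j. {u, v} \<in> edges G" if "{i, j} \<in> edges (complete_ograph t)" for i j
  proof -
    have "i < j \<and> j < t \<or> j < i \<and> i < t"
      using that by (auto simp: complete_ograph_def doubleton_eq_iff)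
    then show ?thesis using kij[of i j] kij[of j i] by (metis insert_commute)
  qed
  ultimately show ?thesis
    unfolding interval_minor_def by (intro exI[of _ I]) (auto simp: complete_ograph_def)
qed

theorem theorem3:
  fixes t :: nat
  assumes "t \<ge> 1"
  shows "\<exists>r::nat. \<forall>G::'a ograph.
           ordered_graph G \<and> \<not> interval_minor (complete_ograph t) G \<longrightarrow> rank G \<le> enat r"
proof (intro exI allI impI)
  fix G :: "'a ograph"
  assume "ordered_graph G \<and> \<not> interval_minor (complete_ograph t) G"
  then have G: "ordered_graph G" and noK: "\<not> interval_minor (complete_ograph t) G" by auto
  have fin: "finite (verts G)" and sub: "prec G \<subseteq> verts G \<times> verts G" and "trans (prec G)"
    and "irrefl (prec G)" and tot: "total_on (verts G) (prec G)"
    using G by (auto simp: ordered_graph_def strict_linear_order_on_def)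
  \<comment> \<open>Counting predecessors embeds the order into the naturals; every vertex will be
    its own block.\<close>
  define f where "f v = card {u. (u, v) \<in> prec G}" for v
  have f: "f u < f v" if uv: "(u, v) \<in> prec G" for u v
    unfolding f_def
  proof (rule psubset_card_mono)
    show "finite {u. (u, v) \<in> prec G}" using fin sub by (auto intro: finite_subset)
    have "u \<notin> {w. (w, u) \<in> prec G}" using \<open>irrefl (prec G)\<close> by (auto simp: irrefl_def)
    then show "{w. (w, u) \<in> prec G} \<subset> {w. (w, v) \<in> prec G}"
      using uv \<open>trans (prec G)\<close> by (auto dest: transD)
  qed
  have inj: "inj_on f (verts G)"
    using tot f by (auto simp: inj_on_def total_on_def) (metis less_irrefl)
  let ?E = "{(f u, f v) | u v. (u, v) \<in> prec G \<and> {u, v} \<in> edges G}"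
  have bg: "block_graph (f ` verts G) ?E id"
    using fin sub f by unfold_locales (auto simp: monotone_on_def)
  have "nat_ograph (f ` verts G) ?E \<in> rank_class (5 * (t - 2) + 2)"
  \<comment> \<open>The empty graph is treated apart: \<open>has_clique_minor\<close> is vacuous for
    \<open>t = 1\<close>, although \<open>K_1\<close> is no minor of it. It is the only graph left
    for \<open>t = 1\<close>, where \<open>t - 2\<close> is truncated to 0.\<close>
  proof (cases "verts G = {}")
    case True
    then have "?E = {}" using sub by auto
    then show ?thesis unfolding True \<open>?E = {}\<close> image_empty by (intro empty_in_rank_class)
  next
    case False
    then have no: "\<not> has_clique_minor ?E id t"
      using interval_minor_of_clique_minor[of G f t, OF G f assms] noK by blast
    have "t \<ge> 2"
    proof (rule ccontr)
      assume "\<not> t \<ge> 2"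
      then have "has_clique_minor ?E id t"
        unfolding has_clique_minor_def by (intro exI[of _ id]) (auto simp: mono_def)
      then show False using no by simp
    qed
    then have t: "t - 2 + 2 = t" by simp
    show ?thesis using block_graph_rank_bounded[OF bg, of "t - 2", unfolded t, OF no] .
  qed
  then have "rename f G \<in> rank_class (5 * (t - 2) + 2)"
    using rename_to_nat_ograph[of G f, OF G f] by (simp del: rank_class.simps)
  then show "rank G \<le> enat (5 * (t - 2) + 2)"
    unfolding rank_def using inj by (intro INF_lower) blast
qed

end
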